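(* Fix $d\ge 3$, $c>0$, $\frac{d-1}{d+1}<\delta<1$ and $M\in(0,1)$; let $p=(c+o_n(1))n^{-d+1+\delta}$ and $\mathcal{H}$ the random $d$-uniform hypergraph on $[n]$ with each $d$-subset a hyperedge independently with probability $p$. Let $q$ be the probability that all pairs in $[d]$ are edges of $\mathrm{Proj}(\mathcal{H})$. Let $\epsilon=\epsilon_n\to 0$ be a sequence such that, with probability $1-o_n(1)$, both $e(\mathcal{H})\in[(1-\epsilon)p\binom nd,(1+\epsilon)p\binom nd]$ and $e(\mathcal{H}_c)\in[(1-\epsilon)q\binom nd,(1+\epsilon)q\binom nd]$. Let $\mathcal{Z}$ be the set of $d$-uniform hypergraphs $H$ on $[n]$ with $e(H)\in[(1-\epsilon)p\binom nd,(1+\epsilon)p\binom nd]$ and $e(H_c)\in[(1-\epsilon)q\binom nd,(1+\epsilon)q\binom nd]$. Let $\mathcal{H}'$ be drawn, conditionally on $\mathrm{Proj}(\mathcal{H})=G$, from the conditional law of $\mathcal{H}$ given $\mathrm{Proj}(\mathcal{H})=G$, independently of $\mathcal{H}$. Then \[ \Pr\Big(\mathcal{H},\mathcal{H}'\in\mathcal{Z},\ |E(\mathcal{H})\cap E(\mathcal{H}')|\ge Mp\tbinom{n}{d}\Big)=o_n(1). \]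
   Context: $\mathrm{Proj}(H)$ is the graph on $[n]$ with $\{i,j\}$ an edge iff some hyperedge of $H$ contains $\{i,j\}$. For a $d$-uniform hypergraph $H$, $H_c$ denotes the $d$-uniform hypergraph whose hyperedges are the $d$-cliques of $\mathrm{Proj}(H)$; $e(\cdot)$ is the number of hyperedges. *)

theory Defs
  imports "HOL-Probability.Probability"
begin

definition dsubsets :: "nat \<Rightarrow> nat \<Rightarrow> nat set set" where
  "dsubsets n d = {S. S \<subseteq> {1..n} \<and> card S = d}"

(* Hypergraphs on {1..n} are identified with their sets of hyperedges, and graphs on {1..n}
   with their sets of two-element edges. *)
definition uniform_hypergraph :: "nat \<Rightarrow> nat \<Rightarrow> nat set set \<Rightarrow> bool" where
  "uniform_hypergraph n d H \<longleftrightarrow> H \<subseteq> dsubsets n d"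

definition proj :: "nat set set \<Rightarrow> nat set set" where
  "proj H = {{i, j} | i j. i \<noteq> j \<and> (\<exists>h\<in>H. {i, j} \<subseteq> h)}"

definition is_clique :: "nat set set \<Rightarrow> nat set \<Rightarrow> bool" where
  "is_clique G S \<longleftrightarrow> (\<forall>i\<in>S. \<forall>j\<in>S. i \<noteq> j \<longrightarrow> {i, j} \<in> G)"

definition clique_hypergraph :: "nat \<Rightarrow> nat \<Rightarrow> nat set set \<Rightarrow> nat set set" where
  "clique_hypergraph n d H = {S \<in> dsubsets n d. is_clique (proj H) S}"

(* bernoulli_pmf truncates its parameter to [0,1]. *)
definition random_hypergraph :: "nat \<Rightarrow> nat \<Rightarrow> real \<Rightarrow> nat set set pmf" where
  "random_hypergraph n d p =
     map_pmf (\<lambda>f. {S \<in> dsubsets n d. f S}) (Pi_pmf (dsubsets n d) False (\<lambda>_. bernoulli_pmf p))"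

definition clique_prob :: "nat \<Rightarrow> nat \<Rightarrow> real \<Rightarrow> real" where
  "clique_prob n d p = measure_pmf.prob (random_hypergraph n d p) {H. is_clique (proj H) {1..d}}"

definition typical :: "nat \<Rightarrow> nat \<Rightarrow> real \<Rightarrow> real \<Rightarrow> nat set set set" where
  "typical n d p \<epsilon> = {H. uniform_hypergraph n d H \<and>
     real (card H) \<in> {(1 - \<epsilon>) * p * real (n choose d) .. (1 + \<epsilon>) * p * real (n choose d)} \<and>
     real (card (clique_hypergraph n d H)) \<in>
       {(1 - \<epsilon>) * clique_prob n d p * real (n choose d) ..
        (1 + \<epsilon>) * clique_prob n d p * real (n choose d)}}"

(* Joint law of (H, H'): given H, the second component is a fresh sample from the law of H
   conditioned on having the projected graph proj H, so H and H' are conditionally independent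
   given their common projection. The conditioning event has positive probability for every H in
   the support, as cond_pmf requires. *)
definition resampled_pair :: "nat \<Rightarrow> nat \<Rightarrow> real \<Rightarrow> (nat set set \<times> nat set set) pmf" where
  "resampled_pair n d p =
     bind_pmf (random_hypergraph n d p) (\<lambda>H.
       map_pmf (\<lambda>H'. (H, H')) (cond_pmf (random_hypergraph n d p) {H'. proj H' = proj H}))"

end

theory Submission
  imports Defs
begin

text \<open>
  Write \<open>m\<close> for the expected number of hyperedges. A typical \<open>H\<close> has about \<open>m\<close> hyperedges and hence
  probability roughly \<open>p\<^sup>m\<close>, and its projection has at most about \<open>(d choose 2) m\<close> edges, so there are
  at most \<open>K\<close> such projections with
  \<open>ln K \<approx> (1 - \<delta>) (d choose 2) m ln n\<close>. A random typical projection therefore has mass at least about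
  \<open>1 / K\<close>. Given \<open>H\<close>, a candidate \<open>H'\<close> consists of cliques of \<open>proj H\<close>; if it overlaps \<open>H\<close> in
  \<open>M m\<close> hyperedges then only \<open>(1 - M) m\<close> of them are free, and since the cliques outnumber the
  hyperedges by at most a factor of about \<open>n powr \<eta>\<close>, where
  \<open>\<eta> = d - 1 - \<delta> - (1 - \<delta>) (d choose 2)\<close>, there are about \<open>n powr (\<eta> (1 - M) m)\<close> candidates.
  As \<open>p\<^sup>m \<approx> n powr (- (d - 1 - \<delta>) m)\<close>, the conditional probability of a large overlap is about
  \<open>n powr (- \<eta> M m)\<close>, up to factors \<open>exp (O(m))\<close>, and \<open>\<eta> > 0\<close> is exactly the condition
  \<open>\<delta> > (d - 1) / (d + 1)\<close>.
\<close>

section \<open>Counting small subsets\<close>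

text \<open>Give \<open>X\<close> the weight \<open>r ^ card X\<close>. Each counted set weighs at
  least \<open>r powr k\<close>, and all subsets of \<open>A\<close> together weigh
  \<open>(r + 1) ^ card A\<close>. The free parameter \<open>r\<close> is later set to the density
  of the sets being counted, which keeps the exponential factor harmless.\<close>

lemma card_small_subsets_le:
  fixes r k :: real
  assumes "finite A" "0 < r" "r \<le> 1"
  shows "real (card {X. X \<subseteq> A \<and> real (card X) \<le> k}) \<le> r powr (-k) * exp (r * real (card A))"
proof -
  let ?S = "{X. X \<subseteq> A \<and> real (card X) \<le> k}"
  have "real (card ?S) * r powr k = (\<Sum>X\<in>?S. r powr k)" by simp
  also have "\<dots> \<le> (\<Sum>X\<in>?S. r ^ card X)"
  proof (rule sum_mono)
    fix X assume "X \<in> ?S"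
    then have "r powr k \<le> r powr real (card X)"
      using assms by (intro powr_mono') auto
    then show "r powr k \<le> r ^ card X" using assms by (simp add: powr_realpow)
  qed
  also have "\<dots> \<le> (\<Sum>X\<in>Pow A. r ^ card X)"
    using assms by (intro sum_mono2) auto
  also have "\<dots> = (r + 1) ^ card A"
    using prod_add[OF assms(1), of "\<lambda>_. r" "\<lambda>_. 1"] by simp
  also have "\<dots> \<le> exp r ^ card A"
    using assms exp_ge_add_one_self[of r] by (intro power_mono) (auto simp: add.commute)
  also have "\<dots> = exp (r * real (card A))"
    by (simp add: exp_of_nat2_mult)
  finally show ?thesis
    using assms by (simp add: powr_minus field_simps)
qed

section \<open>The law of the random hypergraph\<close>

lemma finite_dsubsets: "finite (dsubsets n d)"
  unfolding dsubsets_def by (rule finite_subset[of _ "Pow {1..n}"]) auto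

lemma set_random_hypergraph: "set_pmf (random_hypergraph n d p) \<subseteq> Pow (dsubsets n d)"
  unfolding random_hypergraph_def by auto

lemma finite_set_random_hypergraph: "finite (set_pmf (random_hypergraph n d p))"
  using finite_subset[OF set_random_hypergraph] finite_dsubsets by blast

lemma prob_random_hypergraph_supset:
  assumes "0 \<le> p" "p \<le> 1" "T \<subseteq> dsubsets n d"
  shows "measure_pmf.prob (random_hypergraph n d p) {H. T \<subseteq> H} = p ^ card T"
proof -
  let ?D = "dsubsets n d"
  have "measure_pmf.prob (random_hypergraph n d p) {H. T \<subseteq> H}
      = measure_pmf.prob (Pi_pmf ?D False (\<lambda>_. bernoulli_pmf p))
          (Pi ?D (\<lambda>S. if S \<in> T then {True} else UNIV))"
    unfolding random_hypergraph_def measure_map_pmf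
    using assms(3) by (intro arg_cong[where f = "measure _"]) (auto split: if_splits)
  also have "\<dots> = (\<Prod>S\<in>?D. if S \<in> T then p else 1)"
    using assms by (subst measure_Pi_pmf_Pi[OF finite_dsubsets])
      (auto intro!: prod.cong simp: measure_pmf_single)
  also have "\<dots> = p ^ card T"
    using assms(3) finite_dsubsets by (simp add: prod.If_cases Int_absorb1)
  finally show ?thesis .
qed

text \<open>The factor for absent hyperedges is dropped: masses of single hypergraphs are only ever
  bounded from above, while the normalisation is handled by counting projections.\<close>

lemma pmf_random_hypergraph_le:
  assumes "0 \<le> p" "p \<le> 1" "H \<subseteq> dsubsets n d"
  shows "pmf (random_hypergraph n d p) H \<le> p ^ card H"
proof -
  have "pmf (random_hypergraph n d p) H = measure_pmf.prob (random_hypergraph n d p) {H}"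
    by (simp add: measure_pmf_single)
  also have "\<dots> \<le> measure_pmf.prob (random_hypergraph n d p) {X. H \<subseteq> X}"
    by (intro measure_pmf.finite_measure_mono) auto
  finally show ?thesis using prob_random_hypergraph_supset[OF assms] by simp
qed

lemma card_dsubsets_supset_le:
  assumes "A \<subseteq> {1..n}" "card A \<le> d"
  shows "card {h \<in> dsubsets n d. A \<subseteq> h} \<le> n ^ (d - card A)"
proof -
  have fA: "finite A" using assms finite_subset by blast
  let ?B = "{S. S \<subseteq> {1..n} \<and> card S = d - card A}"
  have "card {h \<in> dsubsets n d. A \<subseteq> h} \<le> card ?B"
  proof (rule card_inj_on_le[of "\<lambda>h. h - A"])
    show "inj_on (\<lambda>h. h - A) {h \<in> dsubsets n d. A \<subseteq> h}"
      by (rule inj_onI) blast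
    show "(\<lambda>h. h - A) ` {h \<in> dsubsets n d. A \<subseteq> h} \<subseteq> ?B"
      using fA by (auto simp: dsubsets_def card_Diff_subset)
    show "finite ?B" by (rule finite_subset[of _ "Pow {1..n}"]) auto
  qed
  also have "\<dots> = n choose (d - card A)" using n_subsets[of "{1..n}"] by simp
  also have "\<dots> \<le> n ^ (d - card A)"
    by (cases "d - card A \<le> n") (auto simp: binomial_le_pow binomial_eq_0)
  finally show ?thesis .
qed

section \<open>Resampling within a fibre\<close>

text \<open>Isolates the conditioning from the combinatorics: \<open>f\<close> stands for
  \<open>proj\<close> and \<open>S\<close> for the typical set. The bound \<open>B\<close> concerns
  unconditioned mass inside a fibre, so only a division by the fibre mass \<open>\<pi> x\<close>
  separates it from the conditional probability.\<close>

lemma prob_resampled_le: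
  fixes \<mu> :: "'a pmf" and f :: "'a \<Rightarrow> 'b" and K B :: real
  assumes fin: "finite (set_pmf \<mu>)"
    and RS: "\<And>x y. (x, y) \<in> R \<Longrightarrow> x \<in> S"
    and "finite (f ` S)" "real (card (f ` S)) \<le> K" "0 < K" "0 < B"
    and B: "\<And>x. x \<in> S \<Longrightarrow> measure_pmf.prob \<mu> {y. f y = f x \<and> (x, y) \<in> R} \<le> B"
  shows "measure_pmf.prob
           (bind_pmf \<mu> (\<lambda>x. map_pmf (\<lambda>y. (x, y)) (cond_pmf \<mu> {y. f y = f x}))) R
         \<le> 2 * sqrt (K * B)"
proof -
  define \<pi> where "\<pi> x = measure_pmf.prob \<mu> {y. f y = f x}" for x
  \<comment> \<open>Fibres of mass at most \<open>\<tau>\<close> carry total mass at most \<open>K * \<tau>\<close>; on every other fibre the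
    conditional probability is at most \<open>B / \<tau>\<close>. This \<open>\<tau>\<close> balances the two.\<close>
  define \<tau> where "\<tau> = sqrt (B / K)"
  have \<tau>: "0 < \<tau>" using assms by (simp add: \<tau>_def)
  have \<pi>_pos: "0 < \<pi> x" if "x \<in> set_pmf \<mu>" for x
    unfolding \<pi>_def using that by (intro measure_pmf_posI) auto
  let ?c = "\<lambda>x. map_pmf (\<lambda>y. (x, y)) (cond_pmf \<mu> {y. f y = f x})"
  have c: "measure_pmf.prob (?c x) R \<le> indicator S x * \<tau> / \<pi> x + B / \<tau>"
    if x: "x \<in> set_pmf \<mu>" for x
  proof (cases "x \<in> S")
    case False
    then have "(\<lambda>y. (x, y)) -` R = {}" using RS by blast
    then show ?thesis using False \<tau> assms by simp
  next
    case True
    have ne: "set_pmf \<mu> \<inter> {y. f y = f x} \<noteq> {}" using x by auto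
    have "measure_pmf.prob (?c x) R = measure_pmf.prob (cond_pmf \<mu> {y. f y = f x}) {y. (x, y) \<in> R}"
      by (simp add: vimage_def)
    also have "\<dots> = measure_pmf.prob (cond_pmf \<mu> {y. f y = f x}) ({y. (x, y) \<in> R} \<inter> set_pmf \<mu>)"
      using ne by (intro measure_prob_cong_0) (auto simp: pmf_cond[OF ne] set_pmf_iff)
    also have "\<dots> = (\<Sum>y\<in>{y. (x, y) \<in> R} \<inter> set_pmf \<mu>. if f y = f x then pmf \<mu> y / \<pi> x else 0)"
      using fin by (subst measure_measure_pmf_finite) (auto simp: pmf_cond[OF ne] \<pi>_def intro!: sum.cong)
    also have "\<dots> = (\<Sum>y\<in>{y. f y = f x \<and> (x, y) \<in> R} \<inter> set_pmf \<mu>. pmf \<mu> y / \<pi> x)"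
      using fin by (intro sum.mono_neutral_cong_right) auto
    also have "\<dots> = measure_pmf.prob \<mu> ({y. f y = f x \<and> (x, y) \<in> R} \<inter> set_pmf \<mu>) / \<pi> x"
      using fin by (subst measure_measure_pmf_finite) (auto simp: sum_divide_distrib)
    also have "\<dots> \<le> B / \<pi> x"
      using B[OF True] \<pi>_pos[OF x] by (intro divide_right_mono) (auto simp: measure_Int_set_pmf)
    finally have le: "measure_pmf.prob (?c x) R \<le> B / \<pi> x" .
    show ?thesis
    proof (cases "\<pi> x \<le> \<tau>")
      case le_\<tau>: True
      have "measure_pmf.prob (?c x) R \<le> 1" by (rule measure_pmf.prob_le_1)
      also have "1 \<le> \<tau> / \<pi> x" using \<pi>_pos[OF x] le_\<tau> by simp
      also have "\<dots> \<le> \<tau> / \<pi> x + B / \<tau>" using \<tau> assms by simp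
      finally show ?thesis using True by simp
    next
      case False
      have "B / \<pi> x \<le> B / \<tau>" using False \<tau> assms by (intro divide_left_mono) auto
      moreover have "0 \<le> \<tau> / \<pi> x" using \<tau> \<pi>_pos[OF x] by simp
      ultimately show ?thesis using le True by simp
    qed
  qed
  have "measure_pmf.prob (bind_pmf \<mu> ?c) R = (\<integral>x. measure_pmf.prob (?c x) R \<partial>\<mu>)"
    using measurable_measure_pmf[of ?c]
    by (subst measure_pmf_bind, subst measure_pmf.measure_bind[where N = "count_space UNIV"]) auto
  also have "\<dots> = (\<Sum>x\<in>set_pmf \<mu>. measure_pmf.prob (?c x) R * pmf \<mu> x)"
    using fin by (intro integral_measure_pmf_real) auto
  also have "\<dots> \<le> (\<Sum>x\<in>set_pmf \<mu>. (indicator S x * \<tau> / \<pi> x + B / \<tau>) * pmf \<mu> x)"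
    using c by (intro sum_mono mult_right_mono) auto
  also have "\<dots> = (\<Sum>x\<in>set_pmf \<mu>. indicator S x * \<tau> / \<pi> x * pmf \<mu> x) + B / \<tau>"
    using sum_pmf_eq_1[OF fin order_refl]
    by (simp add: distrib_right sum.distrib sum_distrib_left[symmetric] del: times_divide_eq_left)
  also have "(\<Sum>x\<in>set_pmf \<mu>. indicator S x * \<tau> / \<pi> x * pmf \<mu> x)
      = (\<Sum>x\<in>set_pmf \<mu> \<inter> S. \<tau> / \<pi> x * pmf \<mu> x)"
    using fin by (intro sum.mono_neutral_cong_right) auto
  \<comment> \<open>Grouped by fibre, the weights \<open>pmf \<mu> x / \<pi> x\<close> add up to at
    most 1, so each value of \<open>f\<close> on \<open>S\<close> contributes at most
    \<open>\<tau>\<close>.\<close>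
  also have "\<dots> = (\<Sum>z\<in>f ` S. \<Sum>x\<in>{x \<in> set_pmf \<mu> \<inter> S. f x = z}. \<tau> / \<pi> x * pmf \<mu> x)"
    using fin assms by (intro sum.group[symmetric]) auto
  also have "\<dots> \<le> (\<Sum>z\<in>f ` S. \<tau>)"
  proof (rule sum_mono)
    fix z assume "z \<in> f ` S"
    let ?A = "{x \<in> set_pmf \<mu> \<inter> S. f x = z}"
    let ?P = "measure_pmf.prob \<mu> {y. f y = z}"
    have "(\<Sum>x\<in>?A. \<tau> / \<pi> x * pmf \<mu> x) = (\<Sum>x\<in>?A. \<tau> / ?P * pmf \<mu> x)"
      by (intro sum.cong) (auto simp: \<pi>_def)
    also have "\<dots> = \<tau> / ?P * measure_pmf.prob \<mu> ?A"
      using fin by (simp add: measure_measure_pmf_finite sum_distrib_left)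
    also have "\<dots> \<le> \<tau> / ?P * ?P"
      using \<tau> by (intro mult_left_mono measure_pmf.finite_measure_mono) auto
    \<comment> \<open>Only an inequality: \<open>z\<close> may come from a point of \<open>S\<close>
      outside the support, and then \<open>?P\<close> can be 0 and the quotient is 0 by
      convention.\<close>
    also have "\<dots> \<le> \<tau>" using \<tau> by simp
    finally show "(\<Sum>x\<in>?A. \<tau> / \<pi> x * pmf \<mu> x) \<le> \<tau>" .
  qed
  also have "\<dots> \<le> \<tau> * K" using assms \<tau> by simp
  finally have "measure_pmf.prob (bind_pmf \<mu> ?c) R \<le> \<tau> * K + B / \<tau>" by simp
  also have "\<tau> * K = sqrt (K * B)"
    using assms by (simp add: \<tau>_def real_sqrt_divide real_sqrt_mult real_div_sqrt field_simps)
  also have "B / \<tau> = sqrt (K * B)"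
    using assms by (simp add: \<tau>_def real_sqrt_divide real_sqrt_mult field_simps)
  finally show ?thesis by simp
qed

section \<open>The exponent inequality behind the threshold for \<delta>\<close>

text \<open>The factorisation shows where the threshold comes from: at \<open>k = 2\<close> the gap
  vanishes for every \<open>\<delta>\<close>, and for \<open>k > 2\<close> its sign is that of
  \<open>\<delta> - (k - 1) / (k + 1)\<close>.\<close>

lemma choose_two_gap:
  fixes \<delta> :: real
  assumes "1 \<le> k"
  shows "2 * (real k - 1 - \<delta> - (1 - \<delta>) * real (k choose 2))
       = (real k - 2) * ((real k + 1) * \<delta> - (real k - 1))"
proof -
  have "2 * (k choose 2) = k * (k - 1)"
    unfolding choose_two by (intro dvd_mult_div_cancel) auto
  then have "real (2 * (k choose 2)) = real (k * (k - 1))" by (rule arg_cong)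
  then have "2 * real (k choose 2) = real k * (real k - 1)" using assms by simp
  then have "2 * ((1 - \<delta>) * real (k choose 2)) = (1 - \<delta>) * (real k * (real k - 1))"
    by (metis mult.left_commute)
  then show ?thesis by (simp add: algebra_simps)
qed

text \<open>The threshold \<open>(k - 1) / (k + 1)\<close> increases with \<open>k\<close>, so the
  condition at \<open>d\<close> covers every smaller \<open>k\<close>. This is needed for hyperedges
  that meet a given \<open>d\<close>-set in only \<open>k\<close> vertices.\<close>

lemma choose_two_le_linear:
  fixes \<delta> :: real
  assumes "2 \<le> k" "k \<le> d" "(real d - 1) / (real d + 1) \<le> \<delta>"
  shows "(1 - \<delta>) * real (k choose 2) \<le> real k - 1 - \<delta>"
proof -
  have d: "(1 - \<delta>) * (real d + 1) \<le> 2" using assms(3) by (simp add: field_simps)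
  have "(1 - \<delta>) * (real k + 1) \<le> 2"
  proof (cases "\<delta> \<le> 1")
    case True
    then have "(1 - \<delta>) * (real k + 1) \<le> (1 - \<delta>) * (real d + 1)"
      using assms by (intro mult_left_mono) auto
    then show ?thesis using d by linarith
  next
    case False
    then have "(1 - \<delta>) * (real k + 1) \<le> 0" by (intro mult_nonpos_nonneg) auto
    then show ?thesis by simp
  qed
  then have "real k - 1 \<le> (real k + 1) * \<delta>" by (simp add: algebra_simps)
  then have "0 \<le> 2 * (real k - 1 - \<delta> - (1 - \<delta>) * real (k choose 2))"
    using assms(1) by (subst choose_two_gap) auto
  then show ?thesis by (simp add: zero_le_mult_iff)
qed

text \<open>At \<open>k = d \<ge> 3\<close> the factor \<open>real d - 2\<close> is positive, so the
  gap is strict; this yields \<open>\<eta> > 0\<close> in the main argument.\<close>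

lemma choose_two_less_linear:
  fixes \<delta> :: real
  assumes "3 \<le> d" "(real d - 1) / (real d + 1) < \<delta>"
  shows "(1 - \<delta>) * real (d choose 2) < real d - 1 - \<delta>"
proof -
  have "real d - 1 < (real d + 1) * \<delta>" using assms(2) by (simp add: field_simps)
  then have "0 < 2 * (real d - 1 - \<delta> - (1 - \<delta>) * real (d choose 2))"
    using assms(1) by (subst choose_two_gap) auto
  then show ?thesis by (simp add: zero_less_mult_iff)
qed

section \<open>Pairs and the probability of a clique\<close>

text \<open>The edge set of the complete graph on \<open>A\<close>. It turns \<open>proj\<close>
  into a union over hyperedges, to which union bounds on cardinalities apply.\<close>

definition two_sets :: "nat set \<Rightarrow> nat set set" where
  "two_sets A = {e. e \<subseteq> A \<and> card e = 2}"

lemma finite_two_sets: "finite A \<Longrightarrow> finite (two_sets A)"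
  unfolding two_sets_def by (rule finite_subset[of _ "Pow A"]) auto

lemma card_two_sets: "finite A \<Longrightarrow> card (two_sets A) = card A choose 2"
  unfolding two_sets_def by (rule n_subsets)

lemma proj_eq_Union: "proj H = (\<Union>h\<in>H. two_sets h)"
  unfolding proj_def two_sets_def card_2_iff by blast

lemma card_Union_two_sets_le:
  assumes "finite F" "\<And>A. A \<in> F \<Longrightarrow> finite A"
  shows "card (\<Union>A\<in>F. two_sets A) \<le> (\<Sum>A\<in>F. card A choose 2)"
proof -
  have "card (\<Union>A\<in>F. two_sets A) \<le> (\<Sum>A\<in>F. card (two_sets A))"
    by (rule card_UN_le[OF assms(1)])
  also have "\<dots> = (\<Sum>A\<in>F. card A choose 2)"
    using assms by (intro sum.cong) (auto simp: card_two_sets)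
  finally show ?thesis .
qed

text \<open>The order is that of a clique in a graph with independent edges of probability
  \<open>n powr - (1 - \<delta>)\<close>. A trace of size \<open>k\<close> extends to at most
  \<open>n ^ (d - k)\<close> hyperedges, so one appears with probability at most
  \<open>C * n powr - (k - 1 - \<delta>)\<close>, which by \<open>choose_two_le_linear\<close> is no
  more than \<open>C\<close> times the price of \<open>k choose 2\<close> such edges. A covering
  family pays for at least \<open>d choose 2\<close> edges. There are at most
  \<open>2 ^ 2 ^ d\<close> families, each of at most \<open>2 ^ d\<close> traces.\<close>

lemma clique_prob_le:
  fixes C \<delta> p :: real
  assumes "1 \<le> d" "d \<le> n" "0 \<le> p" "p \<le> 1" "1 \<le> C" "p \<le> C * n powr - (real d - 1 - \<delta>)"
    and \<delta>: "(real d - 1) / (real d + 1) \<le> \<delta>" "\<delta> \<le> 1"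
  shows "clique_prob n d p \<le> 2 ^ 2 ^ d * C ^ 2 ^ d * n powr (- (1 - \<delta>) * real (d choose 2))"
proof -
  let ?\<mu> = "random_hypergraph n d p"
  let ?b = "real n powr (- (1 - \<delta>) * real (d choose 2))"
  \<comment> \<open>\<open>\<F>\<close> collects the possible families of traces on \<open>{1..d}\<close> that cover every pair. Hyperedges with
    distinct traces are distinct, so the union bound over choices of one hyperedge per trace
    factorises over the family.\<close>
  define \<F> where "\<F> = {F. F \<subseteq> {A. A \<subseteq> {1..d} \<and> 2 \<le> card A} \<and> two_sets {1..d} \<subseteq> (\<Union>A\<in>F. two_sets A)}"
  define E where "E A = {h \<in> dsubsets n d. A \<subseteq> h}" for A
  define E' where "E' A = {h \<in> dsubsets n d. h \<inter> {1..d} = A}" for A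
  have n: "1 \<le> n" using assms by simp
  have fin_F: "finite F" and card_F: "card F \<le> 2 ^ d" if "F \<in> \<F>" for F
  proof -
    have "F \<subseteq> Pow {1..d}" using that by (auto simp: \<F>_def)
    then show "finite F" "card F \<le> 2 ^ d"
      using card_mono[of "Pow {1..d}" F] by (auto simp: card_Pow finite_subset)
  qed
  have "\<F> \<subseteq> Pow (Pow {1..d})" by (auto simp: \<F>_def)
  then have fin_\<F>: "finite \<F>" and card_\<F>: "card \<F> \<le> 2 ^ 2 ^ d"
    using card_mono[of "Pow (Pow {1..d})" \<F>] by (auto simp: card_Pow finite_subset)
  have fin_E: "finite (E A)" "finite (E' A)" for A by (auto simp: E_def E'_def finite_dsubsets)
  have "clique_prob n d p = measure_pmf.prob ?\<mu> ({H. is_clique (proj H) {1..d}} \<inter> set_pmf ?\<mu>)"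
    unfolding clique_prob_def by (simp add: measure_Int_set_pmf)
  also have "\<dots> \<le> measure_pmf.prob ?\<mu> (\<Union>F\<in>\<F>. \<Union>g\<in>PiE F E'. {H. g ` F \<subseteq> H})"
  proof (rule measure_pmf.finite_measure_mono)
    show "{H. is_clique (proj H) {1..d}} \<inter> set_pmf ?\<mu> \<subseteq> (\<Union>F\<in>\<F>. \<Union>g\<in>PiE F E'. {H. g ` F \<subseteq> H})"
    proof safe
      fix H assume cl: "is_clique (proj H) {1..d}" and "H \<in> set_pmf ?\<mu>"
      then have H: "H \<subseteq> dsubsets n d" using set_random_hypergraph by blast
      \<comment> \<open>Traces with fewer than two vertices cover no pair and are left out, so that
        \<open>k \<ge> 2\<close> holds when the exponents are compared.\<close>
      define F where "F = {h \<inter> {1..d} | h. h \<in> H \<and> 2 \<le> card (h \<inter> {1..d})}"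
      have "two_sets {1..d} \<subseteq> (\<Union>A\<in>F. two_sets A)"
      proof
        fix e assume "e \<in> two_sets {1..d}"
        then have e: "e \<subseteq> {1..d}" "card e = 2" by (auto simp: two_sets_def)
        then obtain i j where ij: "e = {i, j}" "i \<noteq> j" by (auto simp: card_2_iff)
        then have "e \<in> proj H" using cl e by (auto simp: is_clique_def)
        then obtain h where h: "h \<in> H" "e \<subseteq> h" by (auto simp: proj_eq_Union two_sets_def)
        have "card e \<le> card (h \<inter> {1..d})" using h e by (intro card_mono) auto
        then show "e \<in> (\<Union>A\<in>F. two_sets A)" using h e by (auto simp: F_def two_sets_def)
      qed
      then have F: "F \<in> \<F>" by (auto simp: \<F>_def F_def)
      have "\<forall>A\<in>F. \<exists>h. h \<in> H \<and> h \<inter> {1..d} = A" by (auto simp: F_def)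
      then obtain g where g: "\<And>A. A \<in> F \<Longrightarrow> g A \<in> H \<and> g A \<inter> {1..d} = A" by metis
      have "restrict g F \<in> PiE F E'" using g subsetD[OF H] by (auto simp: E'_def)
      moreover have "restrict g F ` F \<subseteq> H" using g by auto
      ultimately show "H \<in> (\<Union>F\<in>\<F>. \<Union>g\<in>PiE F E'. {H. g ` F \<subseteq> H})" using F by blast
    qed
  qed simp
  also have "\<dots> \<le> (\<Sum>F\<in>\<F>. measure_pmf.prob ?\<mu> (\<Union>g\<in>PiE F E'. {H. g ` F \<subseteq> H}))"
    using fin_\<F> by (intro measure_pmf.finite_measure_subadditive_finite) auto
  also have "\<dots> \<le> (\<Sum>F\<in>\<F>. C ^ 2 ^ d * ?b)"
  proof (rule sum_mono)
    fix F assume F: "F \<in> \<F>"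
    have fin: "finite F" by (rule fin_F[OF F])
    have A: "A \<subseteq> {1..d}" "2 \<le> card A" "card A \<le> d" if "A \<in> F" for A
      using F that card_mono[of "{1..d}" A] by (auto simp: \<F>_def)
    have "measure_pmf.prob ?\<mu> (\<Union>g\<in>PiE F E'. {H. g ` F \<subseteq> H})
        \<le> (\<Sum>g\<in>PiE F E'. measure_pmf.prob ?\<mu> {H. g ` F \<subseteq> H})"
      using fin fin_E by (intro measure_pmf.finite_measure_subadditive_finite finite_PiE) auto
    also have "\<dots> = (\<Sum>g\<in>PiE F E'. p ^ card F)"
    proof (rule sum.cong)
      fix g assume g: "g \<in> PiE F E'"
      have "inj_on g F"
      proof (rule inj_onI)
        fix A B assume "A \<in> F" "B \<in> F" "g A = g B"
        moreover have "g A \<in> E' A" "g B \<in> E' B" using PiE_mem[OF g] calculation(1,2) by blast+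
        ultimately show "A = B" by (auto simp: E'_def)
      qed
      moreover have "g ` F \<subseteq> dsubsets n d" using g by (auto simp: E'_def dest: PiE_mem)
      ultimately show "measure_pmf.prob ?\<mu> {H. g ` F \<subseteq> H} = p ^ card F"
        using prob_random_hypergraph_supset[OF assms(3,4)] by (simp add: card_image)
    qed simp
    also have "\<dots> = (\<Prod>A\<in>F. p * card (E' A))"
      using fin by (simp add: card_PiE prod.distrib)
    also have "\<dots> \<le> (\<Prod>A\<in>F. C * real n powr (- (1 - \<delta>) * real (card A choose 2)))"
    proof (rule prod_mono, safe)
      fix A assume "A \<in> F"
      note A = A[OF this]
      \<comment> \<open>Exact traces were needed to make the chosen hyperedges distinct; for
        counting it is enough that they contain \<open>A\<close>.\<close>
      have "card (E' A) \<le> card (E A)" using fin_E by (intro card_mono) (auto simp: E_def E'_def)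
      also have "\<dots> \<le> n ^ (d - card A)"
        unfolding E_def using A assms by (intro card_dsubsets_supset_le) auto
      finally have "real (card (E' A)) \<le> real (n ^ (d - card A))" by (rule of_nat_mono)
      also have "\<dots> = real n powr (real d - real (card A))"
        using n A by (simp add: powr_realpow[symmetric] of_nat_diff)
      finally have "p * card (E' A) \<le> (C * n powr - (real d - 1 - \<delta>)) * n powr (real d - real (card A))"
        using assms by (intro mult_mono) auto
      also have "\<dots> = C * n powr - (real (card A) - 1 - \<delta>)"
        by (simp add: algebra_simps flip: powr_add)
      also have "\<dots> \<le> C * n powr (- (1 - \<delta>) * real (card A choose 2))"
        using choose_two_le_linear[OF A(2,3) \<delta>(1)] n assms(5)
        by (intro mult_left_mono powr_mono) (auto simp: algebra_simps)
      finally show "p * card (E' A) \<le> C * n powr (- (1 - \<delta>) * real (card A choose 2))" .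
      show "0 \<le> p * card (E' A)" using assms by simp
    qed
    also have "\<dots> = C ^ card F * n powr (- (1 - \<delta>) * real (\<Sum>A\<in>F. card A choose 2))"
      using fin n by (simp add: prod.distrib powr_sum[symmetric] sum_distrib_left)
    also have "\<dots> \<le> C ^ 2 ^ d * ?b"
    proof -
      have "d choose 2 = card (two_sets {1..d})" by (simp add: card_two_sets)
      also have "\<dots> \<le> card (\<Union>A\<in>F. two_sets A)"
        using F fin finite_subset[OF A(1)]
        by (intro card_mono) (auto simp: \<F>_def intro: finite_two_sets)
      also have "\<dots> \<le> (\<Sum>A\<in>F. card A choose 2)"
        using fin finite_subset[OF A(1)] by (intro card_Union_two_sets_le) auto
      finally have "real (d choose 2) \<le> real (\<Sum>A\<in>F. card A choose 2)" by (rule of_nat_mono)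
      then have "- (1 - \<delta>) * real (\<Sum>A\<in>F. card A choose 2) \<le> - (1 - \<delta>) * real (d choose 2)"
        using assms by (intro mult_left_mono_neg) auto
      then have "n powr (- (1 - \<delta>) * real (\<Sum>A\<in>F. card A choose 2)) \<le> ?b"
        using n by (intro powr_mono) auto
      moreover have "C ^ card F \<le> C ^ 2 ^ d"
        using assms card_F[OF F] by (intro power_increasing) auto
      ultimately show ?thesis using assms by (intro mult_mono) auto
    qed
    finally show "measure_pmf.prob ?\<mu> (\<Union>g\<in>PiE F E'. {H. g ` F \<subseteq> H}) \<le> C ^ 2 ^ d * ?b" .
  qed
  also have "\<dots> = card \<F> * (C ^ 2 ^ d * ?b)" by simp
  also have "\<dots> \<le> 2 ^ 2 ^ d * (C ^ 2 ^ d * ?b)"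
  proof (rule mult_right_mono)
    show "real (card \<F>) \<le> 2 ^ 2 ^ d" using of_nat_mono[OF card_\<F>, where 'a = real] by simp
  qed (use assms in auto)
  finally show ?thesis by (simp add: mult.assoc)
qed

section \<open>Hypergraphs sharing a projection\<close>

lemma proj_subset_two_sets: "H \<subseteq> dsubsets n d \<Longrightarrow> proj H \<subseteq> two_sets {1..n}"
  unfolding proj_eq_Union dsubsets_def two_sets_def by blast

lemma card_proj_le:
  assumes "H \<subseteq> dsubsets n d"
  shows "card (proj H) \<le> card H * (d choose 2)"
proof -
  have fin: "finite H" "\<And>h. h \<in> H \<Longrightarrow> finite h"
    using assms finite_subset[OF assms finite_dsubsets] finite_subset[of _ "{1..n}"]
    by (auto simp: dsubsets_def)
  have "card (proj H) \<le> (\<Sum>h\<in>H. card h choose 2)"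
    unfolding proj_eq_Union using fin by (intro card_Union_two_sets_le) auto
  also have "\<dots> = (\<Sum>h\<in>H. d choose 2)"
    using assms by (intro sum.cong) (auto simp: dsubsets_def)
  finally show ?thesis by simp
qed

lemma subset_clique_hypergraph:
  assumes "H' \<subseteq> dsubsets n d" "proj H' = proj H"
  shows "H' \<subseteq> clique_hypergraph n d H"
proof -
  have "is_clique (proj H') h" if "h \<in> H'" for h
    using that unfolding is_clique_def proj_def by blast
  then show ?thesis using assms by (auto simp: clique_hypergraph_def)
qed

lemma finite_clique_hypergraph: "finite (clique_hypergraph n d H)"
  unfolding clique_hypergraph_def using finite_dsubsets by simp

text \<open>\<open>H'\<close> is determined by \<open>H \<inter> H'\<close> and
  \<open>H' - H\<close>. The first is any subset of \<open>H\<close>, which costs a factor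
  exponential in \<open>card H\<close>; the second is a set of at most \<open>s - t\<close> cliques
  of \<open>proj H\<close>.\<close>

lemma card_overlapping_le:
  fixes s t k r :: real
  assumes "H \<subseteq> dsubsets n d" "0 < r" "r \<le> 1"
  shows "real (card {H'. H' \<subseteq> dsubsets n d \<and> proj H' = proj H \<and> real (card H') \<le> s
                \<and> t \<le> real (card (H \<inter> H'))})
      \<le> exp (real (card H)) * (r powr - (s - t) * exp (r * real (card (clique_hypergraph n d H))))"
    (is "real (card ?L) \<le> _")
proof -
  let ?X = "{X. X \<subseteq> clique_hypergraph n d H \<and> real (card X) \<le> s - t}"
  have fin: "finite H" by (rule finite_subset[OF assms(1) finite_dsubsets])
  have fin_X: "finite ?X"
    by (rule finite_subset[of _ "Pow (clique_hypergraph n d H)"]) (auto simp: finite_clique_hypergraph)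
  have "card ?L \<le> card (Pow H \<times> ?X)"
  proof (rule card_inj_on_le[of "\<lambda>H'. (H \<inter> H', H' - H)"])
    show "inj_on (\<lambda>H'. (H \<inter> H', H' - H)) ?L" by (rule inj_onI) blast
    show "(\<lambda>H'. (H \<inter> H', H' - H)) ` ?L \<subseteq> Pow H \<times> ?X"
    proof safe
      fix H' h assume H': "H' \<subseteq> dsubsets n d" "proj H' = proj H"
        "real (card H') \<le> s" "t \<le> real (card (H \<inter> H'))"
      show "h \<in> clique_hypergraph n d H" if "h \<in> H'" for h
        using subset_clique_hypergraph[OF H'(1,2)] that by blast
      have "finite H'" by (rule finite_subset[OF H'(1) finite_dsubsets])
      then have "card (H \<inter> H') + card (H' - H) = card H'"
        by (metis Int_commute card_Int_Diff)
      then show "real (card (H' - H)) \<le> s - t" using H'(3,4) by linarith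
    qed
    show "finite (Pow H \<times> ?X)" using fin fin_X by simp
  qed
  also have "\<dots> = 2 ^ card H * card ?X" using fin by (simp add: card_cartesian_product card_Pow)
  finally have "real (card ?L) \<le> 2 ^ card H * real (card ?X)"
    using of_nat_mono[where 'a = real] by fastforce
  also have "\<dots> \<le> exp (real (card H)) * (r powr - (s - t) * exp (r * real (card (clique_hypergraph n d H))))"
  proof (intro mult_mono card_small_subsets_le[OF finite_clique_hypergraph assms(2,3)])
    have "(2::real) ^ card H \<le> exp 1 ^ card H"
      using exp_ge_add_one_self[of 1] by (intro power_mono) auto
    then show "(2::real) ^ card H \<le> exp (real (card H))" by (simp flip: exp_of_nat_mult)
  qed auto
  finally show ?thesis .
qed

section \<open>The overlap bound for fixed n\<close>

text \<open>The main term of the exponent carries a factor \<open>ln n\<close>, while all errors are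
  of order \<open>n powr (1 + \<delta>)\<close>, the order of \<open>m\<close> itself. Hence the
  logarithm wins as soon as \<open>2 * a * \<bar>\<epsilon>\<bar>\<close> stays below
  \<open>\<eta> * M\<close> by a fixed margin.\<close>

lemma overlap_prob_le:
  fixes C \<delta> M p \<epsilon> :: real and n d :: nat
  defines "m \<equiv> p * real (n choose d)"
    and "\<eta> \<equiv> real d - 1 - \<delta> - (1 - \<delta>) * real (d choose 2)"
    and "a \<equiv> real d - 1 - \<delta>"
    and "C0 \<equiv> 2 ^ 2 ^ d * C ^ 2 ^ d"
  assumes d: "2 \<le> d" "d \<le> n" and p: "0 < p" "p \<le> 1"
    and C: "1 \<le> C" "p \<le> C * n powr - a"
    and \<delta>: "(real d - 1) / (real d + 1) \<le> \<delta>" "\<delta> \<le> 1" and \<epsilon>: "\<bar>\<epsilon>\<bar> \<le> 1"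
  shows "measure_pmf.prob (resampled_pair n d p)
            {(H, H'). H \<in> typical n d p \<epsilon> \<and> H' \<in> typical n d p \<epsilon> \<and>
                      real (card (H \<inter> H')) \<ge> M * p * real (n choose d)}
      \<le> 2 * sqrt (exp (ln n * m * (2 * a * \<bar>\<epsilon>\<bar> - \<eta> * M)
                      + (1 + 2 * C + 2 * C0 + C * ln C) * n powr (1 + \<delta>)))"
proof -
  let ?\<mu> = "random_hypergraph n d p"
  let ?Z = "typical n d p \<epsilon>"
  let ?R = "{(H, H'). H \<in> ?Z \<and> H' \<in> ?Z \<and> real (card (H \<inter> H')) \<ge> M * p * real (n choose d)}"
  define D where "D = real (d choose 2)"
  define e where "e = \<bar>\<epsilon>\<bar>"
  define x where "x = real n powr (1 + \<delta>)"
  \<comment> \<open>\<open>K\<close> bounds the number of projections of typical hypergraphs.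
    \<open>B\<close> is a bound on the number of candidates \<open>H'\<close> times a bound on the
    mass of each.\<close>
  define K where "K = real n powr ((1 - \<delta>) * (D * ((1 + e) * m))) * exp x"
  define B where "B = exp (2 * m) * (real n powr (\<eta> * ((1 + e) * m - M * m)) * exp (2 * C0 * x))
                      * (C powr m * real n powr (- a * ((1 - e) * m)))"
  have n: "1 \<le> n" using d by simp
  have powr_le_1: "real n powr - s \<le> 1" if "0 \<le> s" for s
    using powr_mono[of "- s" 0 "real n"] n that by simp
  have m: "0 \<le> m" using p by (simp add: m_def)
  have e: "0 \<le> e" "e \<le> 1" "\<epsilon> \<le> e" "- e \<le> \<epsilon>" using \<epsilon> by (auto simp: e_def)
  have \<eta>: "0 \<le> \<eta>" using choose_two_le_linear[OF d(1) order_refl \<delta>(1)] by (simp add: \<eta>_def)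
  have a: "a = \<eta> + (1 - \<delta>) * D" by (simp add: a_def \<eta>_def D_def)
  have binom: "real (n choose d) \<le> real n powr d"
    using binomial_le_pow[OF d(2)] n by (simp add: powr_realpow flip: of_nat_power)
  have m_le: "m \<le> C * x"
  proof -
    have "m \<le> (C * n powr - a) * n powr d"
      unfolding m_def using p C binom by (intro mult_mono) auto
    also have "\<dots> = C * x" using n by (simp add: x_def a_def add.commute flip: powr_add)
    finally show ?thesis .
  qed
  have typical_bounds: "H \<subseteq> dsubsets n d" "real (card H) \<le> (1 + e) * m" "(1 - e) * m \<le> real (card H)"
    "real (card (clique_hypergraph n d H)) \<le> 2 * (clique_prob n d p * real (n choose d))"
    if "H \<in> ?Z" for H
  proof -
    show "H \<subseteq> dsubsets n d" using that by (simp add: typical_def uniform_hypergraph_def)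
    have "real (card H) \<le> (1 + \<epsilon>) * m" "(1 - \<epsilon>) * m \<le> real (card H)"
      using that by (simp_all add: typical_def m_def mult.assoc)
    moreover have "(1 + \<epsilon>) * m \<le> (1 + e) * m" "(1 - e) * m \<le> (1 - \<epsilon>) * m"
      using e m by (auto intro!: mult_right_mono)
    ultimately show "real (card H) \<le> (1 + e) * m" "(1 - e) * m \<le> real (card H)" by linarith+
    have "real (card (clique_hypergraph n d H)) \<le> (1 + \<epsilon>) * (clique_prob n d p * real (n choose d))"
      using that by (simp add: typical_def mult.assoc)
    also have "\<dots> \<le> 2 * (clique_prob n d p * real (n choose d))"
      using e by (intro mult_right_mono) (auto simp: clique_prob_def)
    finally show "real (card (clique_hypergraph n d H)) \<le> 2 * (clique_prob n d p * real (n choose d))" .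
  qed
  have fin_proj: "finite (two_sets {1..n})" by (simp add: finite_two_sets)
  have K: "real (card (proj ` ?Z)) \<le> K"
  proof -
    \<comment> \<open>The order of the edge density of a typical projection, chosen so that
      \<open>?r * n powr 2 = x\<close>.\<close>
    let ?r = "real n powr - (1 - \<delta>)"
    let ?S = "{X. X \<subseteq> two_sets {1..n} \<and> real (card X) \<le> D * ((1 + e) * m)}"
    have "proj ` ?Z \<subseteq> ?S"
    proof safe
      fix H assume H: "H \<in> ?Z"
      show "\<And>f. f \<in> proj H \<Longrightarrow> f \<in> two_sets {1..n}"
        using proj_subset_two_sets[OF typical_bounds(1)[OF H]] by blast
      have "real (card (proj H)) \<le> real (card H * (d choose 2))"
        using card_proj_le[OF typical_bounds(1)[OF H]] by (rule of_nat_mono)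
      also have "\<dots> = D * real (card H)" by (simp add: D_def)
      also have "\<dots> \<le> D * ((1 + e) * m)"
        using typical_bounds(2)[OF H] by (intro mult_left_mono) (auto simp: D_def)
      finally show "real (card (proj H)) \<le> D * ((1 + e) * m)" .
    qed
    moreover have "finite ?S"
      by (rule finite_subset[of _ "Pow (two_sets {1..n})"]) (auto simp: finite_two_sets)
    ultimately have "real (card (proj ` ?Z)) \<le> real (card ?S)" by (intro of_nat_mono card_mono)
    also have "\<dots> \<le> ?r powr - (D * ((1 + e) * m)) * exp (?r * real (card (two_sets {1..n})))"
      using n \<delta> by (intro card_small_subsets_le fin_proj powr_le_1) auto
    also have "\<dots> \<le> K"
      unfolding K_def
    proof (intro mult_mono)
      show "?r powr - (D * ((1 + e) * m)) \<le> real n powr ((1 - \<delta>) * (D * ((1 + e) * m)))"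
        by (simp add: powr_powr algebra_simps)
      have "card (two_sets {1..n}) \<le> n ^ 2"
        using binomial_le_pow[of 2 n] d by (simp add: card_two_sets)
      then have "real (card (two_sets {1..n})) \<le> n powr 2"
        using n by (simp add: powr_realpow flip: of_nat_power)
      then have "?r * real (card (two_sets {1..n})) \<le> ?r * n powr 2" by (rule mult_left_mono) simp
      also have "\<dots> = x"
        unfolding x_def powr_add[symmetric] by (rule arg_cong[where f = "(powr) _"]) simp
      finally show "exp (?r * real (card (two_sets {1..n}))) \<le> exp x" by simp
    qed auto
    finally show ?thesis .
  qed
  have B: "measure_pmf.prob ?\<mu> {H'. proj H' = proj H \<and> (H, H') \<in> ?R} \<le> B" if H: "H \<in> ?Z" for H
  proof -
    \<comment> \<open>The order of the ratio of hyperedges to the bound on the cliques, so that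
      \<open>?r\<close> times the number of cliques is at most \<open>2 * C0 * x\<close>.\<close>
    let ?r = "real n powr - \<eta>"
    let ?A = "{H'. proj H' = proj H \<and> (H, H') \<in> ?R}"
    let ?L = "{H'. H' \<subseteq> dsubsets n d \<and> proj H' = proj H \<and> real (card H') \<le> (1 + e) * m
                \<and> M * m \<le> real (card (H \<inter> H'))}"
    let ?P = "C powr m * real n powr (- a * ((1 - e) * m))"
    have A_L: "?A \<subseteq> ?L" using typical_bounds(1,2) by (auto simp: m_def mult.assoc)
    have fin_L: "finite ?L"
      by (rule finite_subset[of _ "Pow (dsubsets n d)"]) (auto simp: finite_dsubsets)
    have fin_A: "finite ?A" by (rule finite_subset[OF A_L fin_L])
    have pmf_le: "pmf ?\<mu> H' \<le> ?P" if "H' \<in> ?A" for H'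
    proof -
      have H': "H' \<in> ?Z" using that by auto
      have "pmf ?\<mu> H' \<le> p ^ card H'"
        using p typical_bounds(1)[OF H'] by (intro pmf_random_hypergraph_le) auto
      also have "\<dots> = p powr real (card H')" using p by (simp add: powr_realpow)
      \<comment> \<open>As \<open>p \<le> 1\<close>, the lower bound on \<open>card H'\<close> is
        the one that matters here; the counts use the upper bound.\<close>
      also have "\<dots> \<le> p powr ((1 - e) * m)"
        using p typical_bounds(3)[OF H'] by (intro powr_mono') auto
      also have "\<dots> \<le> (C * n powr - a) powr ((1 - e) * m)"
        using p C e m by (intro powr_mono2) auto
      also have "\<dots> = C powr ((1 - e) * m) * real n powr (- a * ((1 - e) * m))"
        using C by (simp add: powr_mult powr_powr)
      also have "\<dots> \<le> ?P"
        using C e m by (intro mult_right_mono powr_mono mult_left_le_one_le) auto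
      finally show ?thesis .
    qed
    have "measure_pmf.prob ?\<mu> ?A = (\<Sum>H'\<in>?A. pmf ?\<mu> H')"
      by (rule measure_measure_pmf_finite[OF fin_A])
    also have "\<dots> \<le> real (card ?A) * ?P" by (rule sum_bounded_above[OF pmf_le])
    also have "\<dots> \<le> real (card ?L) * ?P"
      using card_mono[OF fin_L A_L] by (intro mult_right_mono) auto
    finally have le: "measure_pmf.prob ?\<mu> ?A \<le> real (card ?L) * ?P" .
    have "real (card ?L) \<le> exp (real (card H)) * (?r powr - ((1 + e) * m - M * m)
                  * exp (?r * real (card (clique_hypergraph n d H))))"
      using n \<eta> typical_bounds(1)[OF H] by (intro card_overlapping_le powr_le_1) auto
    also have "\<dots> \<le> exp (2 * m) * (real n powr (\<eta> * ((1 + e) * m - M * m)) * exp (2 * C0 * x))"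
    proof (intro mult_mono)
      have "real (card H) \<le> (1 + e) * m" by (rule typical_bounds(2)[OF H])
      also have "\<dots> \<le> 2 * m" using e m by (intro mult_right_mono) auto
      finally show "exp (real (card H)) \<le> exp (2 * m)" by simp
      show "?r powr - ((1 + e) * m - M * m) \<le> real n powr (\<eta> * ((1 + e) * m - M * m))"
        by (simp add: powr_powr algebra_simps)
      have "real (card (clique_hypergraph n d H)) \<le> 2 * (clique_prob n d p * real (n choose d))"
        by (rule typical_bounds(4)[OF H])
      also have "\<dots> \<le> 2 * ((C0 * n powr (- (1 - \<delta>) * D)) * n powr d)"
        unfolding C0_def D_def using d p C \<delta> binom
        by (intro mult_left_mono mult_mono clique_prob_le) (auto simp: a_def)
      finally have "?r * real (card (clique_hypergraph n d H))
          \<le> ?r * (2 * ((C0 * n powr (- (1 - \<delta>) * D)) * n powr d))"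
        by (rule mult_left_mono) simp
      also have "\<dots> = 2 * C0 * (n powr - \<eta> * n powr (- (1 - \<delta>) * D) * n powr d)" by simp
      also have "n powr - \<eta> * n powr (- (1 - \<delta>) * D) * n powr d = x"
        unfolding x_def powr_add[symmetric]
        by (rule arg_cong[where f = "(powr) _"]) (simp add: \<eta>_def D_def algebra_simps)
      finally show "exp (?r * real (card (clique_hypergraph n d H))) \<le> exp (2 * C0 * x)" by simp
    qed auto
    finally have "real (card ?L) * ?P \<le> B"
      unfolding B_def by (rule mult_right_mono) simp
    with le show ?thesis by linarith
  qed
  have KB: "K * B \<le> exp (ln n * m * (2 * a * e - \<eta> * M) + (1 + 2 * C + 2 * C0 + C * ln C) * x)"
  proof -
    \<comment> \<open>With \<open>a = \<eta> + (1 - \<delta>) * D\<close>, the powers of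
      \<open>n\<close> in the two counts give \<open>a * (1 + e) * m - \<eta> * M * m\<close>, and
      the mass of a candidate subtracts \<open>a * (1 - e) * m\<close>. Only the slack
      \<open>2 * a * e\<close> and the gain \<open>\<eta> * M\<close> survive.\<close>
    have "K * B = exp (ln n * m * (2 * a * e - \<eta> * M) + (x + 2 * m + 2 * C0 * x + m * ln C))"
      using n C unfolding K_def B_def a
      by (simp add: powr_def flip: exp_add) (simp add: algebra_simps)
    also have "\<dots> \<le> exp (ln n * m * (2 * a * e - \<eta> * M) + (1 + 2 * C + 2 * C0 + C * ln C) * x)"
    proof -
      have "m * ln C \<le> C * x * ln C" using m_le C by (intro mult_right_mono) auto
      then have "x + 2 * m + 2 * C0 * x + m * ln C \<le> (1 + 2 * C + 2 * C0 + C * ln C) * x"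
        using m_le by (simp add: algebra_simps)
      then show ?thesis by simp
    qed
    finally show ?thesis .
  qed
  have "measure_pmf.prob (resampled_pair n d p) ?R \<le> 2 * sqrt (K * B)"
    unfolding resampled_pair_def
  proof (rule prob_resampled_le[OF finite_set_random_hypergraph])
    show "finite (proj ` ?Z)"
      using proj_subset_two_sets[OF typical_bounds(1)] fin_proj
      by (intro finite_subset[of "proj ` ?Z" "Pow (two_sets {1..n})"]) auto
    show "0 < K" using n by (simp add: K_def)
    show "0 < B" using n C by (simp add: B_def)
  qed (use K B in auto)
  also have "\<dots> \<le> 2 * sqrt (exp (ln n * m * (2 * a * e - \<eta> * M) + (1 + 2 * C + 2 * C0 + C * ln C) * x))"
    using KB by simp
  finally show ?thesis by (simp add: e_def x_def)
qed

section \<open>Passage to the limit\<close>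

theorem theorem13:
  fixes d :: nat and c \<delta> M :: real and p \<epsilon> :: "nat \<Rightarrow> real"
  assumes "d \<ge> 3" and "c > 0"
    and "(real d - 1) / (real d + 1) < \<delta>" and "\<delta> < 1"
    and "0 < M" and "M < 1"
    and "(\<lambda>n. p n / real n powr (- real d + 1 + \<delta>)) \<longlonglongrightarrow> c"
    and "\<epsilon> \<longlonglongrightarrow> 0"
    and "(\<lambda>n. measure_pmf.prob (random_hypergraph n d (p n)) (typical n d (p n) (\<epsilon> n)))
           \<longlonglongrightarrow> 1"
  shows "(\<lambda>n. measure_pmf.prob (resampled_pair n d (p n))
            {(H, H'). H \<in> typical n d (p n) (\<epsilon> n) \<and> H' \<in> typical n d (p n) (\<epsilon> n) \<and>
                      real (card (H \<inter> H')) \<ge> M * p n * real (n choose d)})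
         \<longlonglongrightarrow> 0"
proof -
  define a where "a = real d - 1 - \<delta>"
  define \<eta> where "\<eta> = real d - 1 - \<delta> - (1 - \<delta>) * real (d choose 2)"
  define C where "C = max 1 (2 * c)"
  define C2 where "C2 = 1 + 2 * C + 2 * (2 ^ 2 ^ d * C ^ 2 ^ d) + C * ln C"
  \<comment> \<open>From \<open>p n > c / 2 * n powr - a\<close> and
    \<open>n choose d \<ge> (n / d) ^ d\<close>, so that eventually
    \<open>c3 * n powr (1 + \<delta>) \<le> m\<close>.\<close>
  define c3 where "c3 = c / 2 / real d ^ d"
  define c4 where "c4 = c3 * (\<eta> * M / 2)"
  let ?P = "\<lambda>n. measure_pmf.prob (resampled_pair n d (p n))
            {(H, H'). H \<in> typical n d (p n) (\<epsilon> n) \<and> H' \<in> typical n d (p n) (\<epsilon> n) \<and>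
                      real (card (H \<inter> H')) \<ge> M * p n * real (n choose d)}"
  have "0 \<le> (real d - 1) / (real d + 1)" using assms(1) by simp
  then have \<delta>: "0 < \<delta>" using assms(3) by linarith
  have a: "1 < a" using assms(1,4) by (simp add: a_def)
  have \<eta>: "0 < \<eta>" using choose_two_less_linear[OF assms(1,3)] by (simp add: \<eta>_def)
  have C: "1 \<le> C" "2 * c \<le> C" by (auto simp: C_def)
  have c3: "0 < c3" and c4: "0 < c4" using assms(1,2,5) \<eta> by (auto simp: c3_def c4_def)
  have ln_top: "filterlim (\<lambda>n. c4 * ln (real n)) at_top sequentially"
    using c4 by (intro filterlim_tendsto_pos_mult_at_top[OF tendsto_const]
        filterlim_compose[OF ln_at_top filterlim_real_sequentially])
  have ratio: "(\<lambda>n. p n / real n powr - a) \<longlonglongrightarrow> c"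
    using assms(7) by (simp add: a_def algebra_simps)
  have "eventually (\<lambda>n. p n / real n powr - a < 2 * c) sequentially"
    "eventually (\<lambda>n. c / 2 < p n / real n powr - a) sequentially"
    using order_tendstoD(2)[OF ratio, of "2 * c"] order_tendstoD(1)[OF ratio, of "c / 2"] assms(2)
    by auto
  moreover have "(\<lambda>n. C * real n powr - a) \<longlonglongrightarrow> 0"
    using a by (intro tendsto_mult_right_zero tendsto_neg_powr filterlim_real_sequentially) auto
  then have "eventually (\<lambda>n. C * real n powr - a < 1) sequentially" by (rule order_tendstoD) simp
  moreover have "(\<lambda>n. \<bar>\<epsilon> n\<bar>) \<longlonglongrightarrow> 0" using assms(8) by (rule tendsto_rabs_zero)
  \<comment> \<open>The second threshold makes \<open>2 * a * \<bar>\<epsilon> n\<bar>\<close>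
    smaller than half of \<open>\<eta> * M\<close>; the other half is what enters
    \<open>c4\<close>.\<close>
  then have "eventually (\<lambda>n. \<bar>\<epsilon> n\<bar> < 1) sequentially"
    "eventually (\<lambda>n. \<bar>\<epsilon> n\<bar> < \<eta> * M / (4 * a)) sequentially"
    using a \<eta> assms(5) by (auto intro!: order_tendstoD)
  moreover have "eventually (\<lambda>n. C2 \<le> c4 * ln (real n)) sequentially"
    using ln_top by (simp add: filterlim_at_top)
  moreover have "eventually (\<lambda>n. d \<le> n) sequentially" by (rule eventually_ge_at_top)
  ultimately have bound: "eventually (\<lambda>n. ?P n \<le> 2 * sqrt (exp (C2 - c4 * ln (real n)))) sequentially"
  proof eventually_elim
    case (elim n)
    define m where "m = p n * real (n choose d)"
    define x where "x = real n powr (1 + \<delta>)"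
    have n: "1 \<le> n" using elim assms(1) by simp
    have x: "1 \<le> x" using n \<delta> by (simp add: x_def ge_one_powr_ge_zero)
    have p_less: "p n < 2 * c * n powr - a" and p_gr: "c / 2 * n powr - a < p n"
      using elim(1,2) n by (simp_all add: pos_divide_less_eq pos_less_divide_eq)
    have "0 < c / 2 * n powr - a" using assms(2) n by simp
    then have p_pos: "0 < p n" using p_gr by linarith
    have "2 * c * n powr - a \<le> C * n powr - a" using C by (intro mult_right_mono) auto
    then have p_le: "p n \<le> C * n powr - a" and p_le_1: "p n \<le> 1" using p_less elim(3) by linarith+
    have "?P n \<le> 2 * sqrt (exp (ln n * m * (2 * a * \<bar>\<epsilon> n\<bar> - \<eta> * M) + C2 * x))"
      unfolding m_def a_def \<eta>_def C2_def x_def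
      using elim(4,7) assms(1,3,4) p_pos p_le p_le_1 C(1) by (intro overlap_prob_le) (auto simp: a_def)
    also have "\<dots> \<le> 2 * sqrt (exp (C2 - c4 * ln (real n)))"
    proof -
      have "c3 * x = c / 2 * n powr - a * (real n / real d) ^ d"
      proof -
        have "x = n powr - a * n ^ d"
          using n by (simp add: x_def a_def algebra_simps flip: powr_realpow powr_add)
        then show ?thesis by (simp add: c3_def power_divide)
      qed
      also have "\<dots> \<le> m"
        unfolding m_def using p_gr p_pos elim(7) by (intro mult_mono binomial_ge_n_over_k_pow_k) auto
      finally have m: "c3 * x \<le> m" .
      have "4 * a * \<bar>\<epsilon> n\<bar> < \<eta> * M" using elim(5) a by (simp add: field_simps)
      then have "ln n * m * (2 * a * \<bar>\<epsilon> n\<bar> - \<eta> * M) \<le> ln n * m * - (\<eta> * M / 2)"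
        using n p_pos by (intro mult_left_mono) (auto simp: m_def)
      also have "\<dots> = - (ln n * (\<eta> * M / 2) * m)" by simp
      also have "\<dots> \<le> - (ln n * (\<eta> * M / 2) * (c3 * x))"
        using m n \<eta> assms(5) by (intro le_imp_neg_le mult_left_mono) auto
      also have "\<dots> = - (c4 * ln n) * x" by (simp add: c4_def)
      finally have "ln n * m * (2 * a * \<bar>\<epsilon> n\<bar> - \<eta> * M) + C2 * x \<le> (C2 - c4 * ln n) * x"
        by (simp add: algebra_simps)
      \<comment> \<open>The coefficient is eventually nonpositive, so \<open>x\<close> may be
        lowered to 1. The remaining bound decays only like a power of \<open>n\<close>, which is
        enough.\<close>
      also have "\<dots> \<le> (C2 - c4 * ln n) * 1"
        using elim(6) x by (intro mult_left_mono_neg) auto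
      finally show ?thesis by simp
    qed
    finally show ?case .
  qed
  have "filterlim (\<lambda>n. C2 - c4 * ln (real n)) at_bot sequentially"
    using filterlim_tendsto_add_at_top[OF tendsto_const[of "- C2"] ln_top]
    by (simp add: filterlim_uminus_at_bot)
  then have "(\<lambda>n. exp (C2 - c4 * ln (real n))) \<longlonglongrightarrow> 0" by (rule filterlim_compose[OF exp_at_bot])
  then have "(\<lambda>n. sqrt (exp (C2 - c4 * ln (real n)))) \<longlonglongrightarrow> 0"
    using tendsto_real_sqrt by fastforce
  then have lim: "(\<lambda>n. 2 * sqrt (exp (C2 - c4 * ln (real n)))) \<longlonglongrightarrow> 0"
    by (rule tendsto_mult_right_zero)
  show ?thesis
    by (rule tendsto_sandwich[OF _ bound tendsto_const lim]) simp
qed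

end
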